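(* Let $Q=(q_0,q_1)\in(1,\infty)^2$ satisfy $q_0+q_1\ge q_0q_1$. Let $\mu_{g,Q}$ and $\mu_{l,Q}$ be the unique absolutely continuous invariant probability measures on $I_Q=\left[0,\frac{1}{q_1-1}\right]$ of the greedy map $G$ and of the lazy map $L$, respectively. Put $r_Q=\frac{q_0}{q_1}$ and $\ell_Q=\frac{q_1}{q_0(q_1-1)}-1$. (i) The measure $\mu_{g,Q}$ is equivalent to the Lebesgue measure $m$ on the interval $[0,r_Q)$, and vanishes outside it, i.e. $\mu_{g,Q}(I_Q\setminus[0,r_Q))=0$. (ii) The measure $\mu_{l,Q}$ is equivalent to the Lebesgue measure $m$ on the interval $\left(\ell_Q,\frac{1}{q_1-1}\right]$, and vanishes outside it, i.e. $\mu_{l,Q}\left(I_Q\setminus\left(\ell_Q,\frac{1}{q_1-1}\right]\right)=0$.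
   Context: For $Q=(q_0,q_1)\in(1,\infty)^2$ with $q_0+q_1\ge q_0q_1$, put $I_Q=\left[0,\frac{1}{q_1-1}\right]$. The greedy map $G:I_Q\to I_Q$ is defined by $G(x)=q_0x$ if $x\in\left[0,\frac1{q_1}\right)$ and $G(x)=q_1x-1$ if $x\in\left[\frac1{q_1},\frac1{q_1-1}\right]$. The lazy map $L:I_Q\to I_Q$ is defined by $L(x)=q_0x$ if $x\in\left[0,\frac{1}{q_0(q_1-1)}\right]$ and $L(x)=q_1x-1$ if $x\in\left(\frac{1}{q_0(q_1-1)},\frac{1}{q_1-1}\right]$. $m$ denotes the Lebesgue measure. Each of $G$ and $L$ has a unique invariant probability measure on $I_Q$ that is absolutely continuous with respect to $m$; these are denoted $\mu_{g,Q}$ and $\mu_{l,Q}$. Two measures are equivalent on a set $X$ if they have the same null sets among the measurable subsets of $X$. *)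

theory Defs
  imports "HOL-Probability.Probability"
begin

definition I_Q :: "real \<Rightarrow> real \<Rightarrow> real set" where
  "I_Q q0 q1 = {0..1 / (q1 - 1)}"

text \<open>The greedy and lazy maps are total functions on the reals; only their values on
  \<^term>\<open>I_Q q0 q1\<close>, which they map into itself if \<^prop>\<open>q0 + q1 \<ge> q0 * q1\<close>, are relevant.\<close>

definition greedy :: "real \<Rightarrow> real \<Rightarrow> real \<Rightarrow> real" where
  "greedy q0 q1 x = (if x < 1 / q1 then q0 * x else q1 * x - 1)"

definition lazy :: "real \<Rightarrow> real \<Rightarrow> real \<Rightarrow> real" where
  "lazy q0 q1 x = (if x \<le> 1 / (q0 * (q1 - 1)) then q0 * x else q1 * x - 1)"

definition r_Q :: "real \<Rightarrow> real \<Rightarrow> real" where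
  "r_Q q0 q1 = q0 / q1"

definition l_Q :: "real \<Rightarrow> real \<Rightarrow> real" where
  "l_Q q0 q1 = q1 / (q0 * (q1 - 1)) - 1"

abbreviation leb_on :: "real set \<Rightarrow> real measure" where
  "leb_on X \<equiv> restrict_space lborel X"

text \<open>Absolutely continuous invariant probability measures of a map \<open>T\<close> on \<open>X\<close>, as measures on
  the Borel subsets of \<open>X\<close>. In the library, \<^term>\<open>absolutely_continuous M N\<close> says that \<open>N\<close> is
  absolutely continuous with respect to \<open>M\<close>.\<close>

definition acim :: "real set \<Rightarrow> (real \<Rightarrow> real) \<Rightarrow> real measure \<Rightarrow> bool" where
  "acim X T \<mu> \<longleftrightarrow>
     sets \<mu> = sets (leb_on X) \<and> prob_space \<mu> \<and>
     T \<in> measurable \<mu> \<mu> \<and> distr \<mu> \<mu> T = \<mu> \<and>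
     absolutely_continuous (leb_on X) \<mu>"

text \<open>Membership in \<^const>\<open>null_sets\<close> includes measurability.\<close>

definition equivalent_on :: "'a set \<Rightarrow> 'a measure \<Rightarrow> 'a measure \<Rightarrow> bool" where
  "equivalent_on X M N \<longleftrightarrow> (\<forall>A\<subseteq>X. A \<in> null_sets M \<longleftrightarrow> A \<in> null_sets N)"

end

theory Submission
  imports Defs
begin

text \<open>
  Let \<open>T\<close> be the greedy map, \<open>c = 1 / q1\<close> its discontinuity, \<open>r = q0 / q1\<close> and
  \<open>e = 1 / (q1 - 1)\<close>. The interval \<open>[0, r)\<close> is mapped into itself, and the points between \<open>r\<close> and
  the repelling fixed point \<open>e\<close> are pushed down into it; invariance of a measure \<open>\<mu>\<close> therefore squeezes
  its mass on \<open>[r, e]\<close> onto the single point \<open>e\<close>, which is null by absolute continuity.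

  The other half is a strong form of ergodicity with respect to Lebesgue measure alone
  (\<open>strongly_ergodic\<close>): a set \<open>B\<close> with \<open>T\<^sup>-\<^sup>1 B \<inter> [0, r) \<subseteq> B\<close> that meets \<open>[0, r)\<close> in positive measure
  has full measure there. Given this, let \<open>A \<subseteq> [0, r)\<close> be a \<open>\<mu>\<close>-null set. The union \<open>B\<close> of the
  \<open>T\<^sup>-\<^sup>n A\<close> is \<open>\<mu>\<close>-null as well, so it cannot have full Lebesgue measure, and \<open>A \<subseteq> B\<close> is Lebesgue-null.

  The slopes \<open>q0\<close> and \<open>q1\<close> may be smaller than \<open>2\<close>, so images of short intervals can be cut
  at \<open>c\<close> faster than they grow. What saves the argument is that the right branch sends \<open>c\<close> to the
  fixed point \<open>0\<close>. Take any \<open>x < y\<close> in \<open>[0, r)\<close>. Since \<open>T\<close> expands, \<open>c\<close> eventually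
  separates the iterates of \<open>x\<close> and \<open>y\<close>, with \<open>y\<close> on the right side; the part of \<open>[x, y]\<close> to the right
  of the cut is then mapped to an interval starting at \<open>0\<close>, and such an interval is
  only stretched by \<open>q0\<close> until it covers \<open>[0, c)\<close>. Hence arbitrarily short intervals around
  every point of \<open>(0, r)\<close> are mapped affinely by some iterate of \<open>T\<close> onto an interval between \<open>[0, c)\<close> and \<open>[0, r)\<close>
  (\<open>full_branch\<close>). By affinity the set \<open>B\<close> has at least a fixed
  positive proportion of each of them, and a Vitali covering of the complement of \<open>B\<close> by such intervals
  shows that this complement is null (\<open>null_set_if_disjoint_positive_density\<close>).

  The lazy map is conjugate, by the decreasing affine bijection between the two intervals, to the
  greedy map with \<open>q0\<close> and \<open>q1\<close> exchanged.
\<close>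

section \<open>Sets of positive lower density\<close>

lemma Vitali_covering_Icc:
  fixes S :: "real set" and K :: "(real \<times> real) set"
  assumes K: "\<And>u w. (u, w) \<in> K \<Longrightarrow> u < w"
    and fine: "\<And>x d. x \<in> S \<Longrightarrow> 0 < d \<Longrightarrow> \<exists>u w. (u, w) \<in> K \<and> x \<in> {u..w} \<and> w - u < d"
  obtains C where "countable C" "C \<subseteq> K" "disjoint_family_on (\<lambda>(u, w). {u..w}) C"
    "negligible (S - (\<Union>(u, w)\<in>C. {u..w}))"
proof -
  define m where "m = (\<lambda>(u, w). (u + w) / 2 :: real)"
  define \<rho> where "\<rho> = (\<lambda>(u, w). (w - u) / 2 :: real)"
  have ball: "cball (m i) (\<rho> i) = (case i of (u, w) \<Rightarrow> {u..w})" for i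
    by (cases i) (simp add: m_def \<rho>_def cball_eq_atLeastAtMost field_simps)
  have 1: "0 < \<rho> i" if "i \<in> K" for i
    using K that by (cases i) (auto simp: \<rho>_def)
  have 2: "\<exists>i. i \<in> K \<and> x \<in> cball (m i) (\<rho> i) \<and> \<rho> i < d" if x: "x \<in> S" and d: "0 < d" for x d
  proof -
    obtain u w where uw: "(u, w) \<in> K" "x \<in> {u..w}" "w - u < d"
      using fine[OF x d] by blast
    have "\<rho> (u, w) < d" using uw(3) K[OF uw(1)] by (simp add: \<rho>_def)
    then show ?thesis using uw by (intro exI[of _ "(u, w)"]) (simp add: ball)
  qed
  obtain C where C: "countable C" "C \<subseteq> K"
    "pairwise (\<lambda>i j. disjnt (cball (m i) (\<rho> i)) (cball (m j) (\<rho> j))) C"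
    "negligible (S - (\<Union>i\<in>C. cball (m i) (\<rho> i)))"
    using Vitali_covering_theorem_cballs[of K \<rho> S m, OF 1 2] by blast
  show thesis
  proof (rule that[OF C(1,2)])
    show "disjoint_family_on (\<lambda>(u, w). {u..w}) C"
      using C(3) unfolding ball by (auto simp: disjoint_family_on_def pairwise_def disjnt_def)
    show "negligible (S - (\<Union>(u, w)\<in>C. {u..w}))"
      using C(4) unfolding ball .
  qed
qed

text \<open>
  A substitute for the Lebesgue density theorem with intervals that contain \<open>x\<close> off centre. If \<open>U\<close> is
  an open neighbourhood of \<open>S\<close> with \<open>U - S\<close> small, disjoint intervals inside \<open>U\<close> cover almost
  all of \<open>S\<close>, and \<open>B\<close> fills a proportion \<open>\<kappa>\<close> of each. As the part they contain of \<open>B\<close> lies in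
  \<open>U - S\<close>, the product of \<open>\<kappa>\<close> and the measure of \<open>S\<close> is arbitrarily small.
\<close>

lemma null_set_if_disjoint_positive_density:
  fixes S B :: "real set" and \<kappa> :: real
  assumes [measurable]: "S \<in> sets borel" "B \<in> sets borel" and disj: "S \<inter> B = {}" and \<kappa>: "0 < \<kappa>"
    and dens: "\<And>x d. x \<in> S \<Longrightarrow> 0 < d \<Longrightarrow> \<exists>u w. u < w \<and> x \<in> {u..w} \<and> w - u < d
      \<and> ennreal (\<kappa> * (w - u)) \<le> emeasure lborel (B \<inter> {u..w})"
  shows "S \<in> null_sets lborel"
proof -
  have bound: "ennreal \<kappa> * emeasure lborel S \<le> ennreal \<epsilon>" if \<epsilon>: "0 < \<epsilon>" for \<epsilon>
  proof -
    obtain U where U: "open U" "S \<subseteq> U" "emeasure lborel (U - S) < ennreal \<epsilon>"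
      using outer_regular_lborel[OF assms(1) \<epsilon>] by blast
    have [measurable]: "U \<in> sets borel" using U(1) by simp
    define K where "K = {(u, w). u < w \<and> {u..w} \<subseteq> U
      \<and> ennreal (\<kappa> * (w - u)) \<le> emeasure lborel (B \<inter> {u..w})}"
    have fine: "\<exists>u w. (u, w) \<in> K \<and> x \<in> {u..w} \<and> w - u < d" if x: "x \<in> S" and d: "0 < d" for x d
    proof -
      obtain \<delta> where \<delta>: "0 < \<delta>" "ball x \<delta> \<subseteq> U"
        using U x openE by blast
      obtain u w where uw: "u < w" "x \<in> {u..w}" "w - u < min d \<delta>"
        "ennreal (\<kappa> * (w - u)) \<le> emeasure lborel (B \<inter> {u..w})"
        using dens[OF x, of "min d \<delta>"] d \<delta>(1) by auto
      have "{u..w} \<subseteq> ball x \<delta>"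
        using uw by (auto simp: dist_real_def)
      then show ?thesis using uw \<delta> unfolding K_def by auto
    qed
    obtain C where C: "countable C" "C \<subseteq> K" "disjoint_family_on (\<lambda>(u, w). {u..w}) C"
      "negligible (S - (\<Union>(u, w)\<in>C. {u..w}))"
    proof (rule Vitali_covering_Icc[of K S, OF _ fine])
      show "u < w" if "(u, w) \<in> K" for u w using that by (simp add: K_def)
    qed
    define I where "I = (\<lambda>(u, w). {u..w} :: real set)"
    have [measurable]: "I i \<in> sets borel" for i by (cases i) (simp add: I_def)
    have CU[measurable]: "(\<Union>i\<in>C. I i) \<in> sets borel" "(\<Union>i\<in>C. B \<inter> I i) \<in> sets borel"
      using C(1) by (auto intro!: sets.countable_UN'')
    have null: "S - (\<Union>i\<in>C. I i) \<in> null_sets lborel"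
      using C(4) unfolding negligible_iff_null_sets I_def[symmetric]
      by (subst (asm) null_sets_completion_iff) (auto)
    have "emeasure lborel S \<le> emeasure lborel ((\<Union>i\<in>C. I i) \<union> (S - (\<Union>i\<in>C. I i)))"
      by (rule emeasure_mono) auto
    also have "\<dots> = emeasure lborel (\<Union>i\<in>C. I i)"
      by (rule emeasure_Un_null_set[OF _ null]) simp
    also have "\<dots> = (\<integral>\<^sup>+i. emeasure lborel (I i) \<partial>count_space C)"
      using C(1,3) by (intro emeasure_UN_countable) (auto simp: I_def)
    finally have "ennreal \<kappa> * emeasure lborel S \<le> ennreal \<kappa> * (\<integral>\<^sup>+i. emeasure lborel (I i) \<partial>count_space C)"
      by (rule mult_left_mono) simp
    also have "\<dots> = (\<integral>\<^sup>+i. ennreal \<kappa> * emeasure lborel (I i) \<partial>count_space C)"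
      by (rule nn_integral_cmult[symmetric]) simp
    also have "\<dots> \<le> (\<integral>\<^sup>+i. emeasure lborel (B \<inter> I i) \<partial>count_space C)"
    proof (rule nn_integral_mono)
      fix i assume "i \<in> space (count_space C)"
      then have "i \<in> K" using C(2) by auto
      then show "ennreal \<kappa> * emeasure lborel (I i) \<le> emeasure lborel (B \<inter> I i)"
        using \<kappa> by (cases i) (auto simp: K_def I_def ennreal_mult)
    qed
    also have "\<dots> = emeasure lborel (\<Union>i\<in>C. B \<inter> I i)"
    proof (rule emeasure_UN_countable[symmetric])
      show "disjoint_family_on (\<lambda>i. B \<inter> I i) C"
        using C(3) unfolding I_def[symmetric] disjoint_family_on_def by blast
    qed (use C(1) in auto)
    also have "\<dots> \<le> emeasure lborel (U - S)"
    proof (rule emeasure_mono)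
      have "I i \<subseteq> U" if "i \<in> C" for i
        using C(2) that by (cases i) (auto simp: K_def I_def)
      then show "(\<Union>i\<in>C. B \<inter> I i) \<subseteq> U - S" using disj by auto
    qed simp
    finally show ?thesis using U(3) by simp
  qed
  have "ennreal \<kappa> * emeasure lborel S \<le> 0"
    by (rule ennreal_le_epsilon) (use bound in auto)
  then show ?thesis using \<kappa> by (auto simp: null_sets_def)
qed

section \<open>Absolutely continuous invariant measures and their images\<close>

lemma emeasure_lborel_affine_preimage:
  fixes s z :: real
  assumes "s \<noteq> 0" and [measurable]: "B \<in> sets borel"
  shows "emeasure lborel {t. s * (t - z) \<in> B} = ennreal \<bar>1 / s\<bar> * emeasure lborel B"
proof -
  have *: "lborel = density (distr lborel borel (\<lambda>x. z + (1/s) * x)) (\<lambda>_. ennreal \<bar>1/s\<bar>)"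
    using assms by (intro lborel_real_affine) auto
  have "emeasure lborel {t. s * (t - z) \<in> B} = ennreal \<bar>1/s\<bar> * emeasure lborel ((\<lambda>x. z + (1/s)*x) -` {t. s * (t - z) \<in> B})"
    using assms(1) by (subst *) (simp add: emeasure_density_const emeasure_distr)
  also have "(\<lambda>x. z + (1/s)*x) -` {t. s * (t - z) \<in> B} = B"
    using assms(1) by auto
  finally show ?thesis .
qed

lemma acim_sets_iff:
  assumes "acim X T \<mu>" "X \<in> sets borel"
  shows "A \<in> sets \<mu> \<longleftrightarrow> A \<in> sets borel \<and> A \<subseteq> X"
  using assms by (auto simp: acim_def sets_restrict_space_iff)

lemma acim_space: assumes "acim X T \<mu>" "X \<in> sets borel" shows "space \<mu> = X"
  using assms sets_eq_imp_space_eq[of \<mu> "leb_on X"] by (auto simp: acim_def space_restrict_space)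

lemma acim_null_sets:
  assumes "acim X T \<mu>" "X \<in> sets borel" "N \<subseteq> X" "N \<in> null_sets lborel"
  shows "N \<in> null_sets \<mu>"
  using assms null_sets_restrict_space[of X lborel N]
  by (auto simp: acim_def absolutely_continuous_def)

lemma acim_invariant:
  assumes "acim X T \<mu>" "X \<in> sets borel" "A \<in> sets \<mu>"
  shows "emeasure \<mu> (T -` A \<inter> X) = emeasure \<mu> A"
proof -
  have "emeasure (distr \<mu> \<mu> T) A = emeasure \<mu> (T -` A \<inter> X)"
    using assms acim_space[OF assms(1,2)] by (subst emeasure_distr) (auto simp: acim_def)
  then show ?thesis using assms by (simp add: acim_def)
qed

lemma measurable_acim:
  assumes "acim X T \<mu>" and "\<psi> \<in> borel_measurable borel" "\<psi> ` X \<subseteq> Y"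
  shows "\<psi> \<in> measurable \<mu> (leb_on Y)"
proof -
  have "\<psi> \<in> measurable (leb_on X) (leb_on Y)"
    using assms by (intro measurable_restrict_space3) auto
  then show ?thesis
    using assms measurable_cong_sets[of \<mu> "leb_on X" "leb_on Y" "leb_on Y"] by (auto simp: acim_def)
qed

text \<open>
  This carries invariant measures of a lazy map over to a greedy map: the intertwining relation
  preserves invariance, and non-singularity of \<open>\<psi>\<close> preserves absolute continuity.
\<close>

lemma acim_distr:
  assumes ac: "acim X S \<mu>" and X: "X \<in> sets borel" and Y: "Y \<in> sets borel"
    and \<psi>: "\<psi> \<in> borel_measurable borel" "\<psi> ` X \<subseteq> Y"
    and T: "T \<in> borel_measurable borel" "T ` Y \<subseteq> Y"
    and conj: "\<And>x. \<psi> (S x) = T (\<psi> x)"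
    and null: "\<And>N. N \<in> null_sets lborel \<Longrightarrow> \<psi> -` N \<in> null_sets lborel"
  shows "acim Y T (distr \<mu> (leb_on Y) \<psi>)"
proof -
  let ?\<nu> = "distr \<mu> (leb_on Y) \<psi>"
  have m\<psi>: "\<psi> \<in> measurable \<mu> (leb_on Y)" by (rule measurable_acim[OF ac \<psi>])
  have mT: "T \<in> measurable (leb_on Y) (leb_on Y)"
    using T by (intro measurable_restrict_space3) auto
  have mS: "S \<in> measurable \<mu> \<mu>" "distr \<mu> \<mu> S = \<mu>" "prob_space \<mu>"
    using ac by (auto simp: acim_def)
  have "distr ?\<nu> (leb_on Y) T = distr \<mu> (leb_on Y) (T \<circ> \<psi>)"
    by (rule distr_distr[OF mT m\<psi>])
  also have "T \<circ> \<psi> = \<psi> \<circ> S" using conj by auto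
  also have "distr \<mu> (leb_on Y) (\<psi> \<circ> S) = distr (distr \<mu> \<mu> S) (leb_on Y) \<psi>"
    by (rule distr_distr[OF m\<psi> mS(1), symmetric])
  also have "\<dots> = ?\<nu>" by (simp add: mS)
  finally have inv: "distr ?\<nu> ?\<nu> T = ?\<nu>"
    by (simp cong: distr_cong)
  have "absolutely_continuous (leb_on Y) ?\<nu>"
    unfolding absolutely_continuous_def
  proof
    fix N assume N: "N \<in> null_sets (leb_on Y)"
    then have N': "N \<subseteq> Y" "N \<in> null_sets lborel" using Y by (auto simp: null_sets_restrict_space)
    have "\<psi> -` N \<inter> X \<in> null_sets lborel"
      using null_sets.Int[OF null[OF N'(2)]] X null[OF N'(2)] null_set_Int2[of "\<psi> -` N" lborel X] by simp
    then have "\<psi> -` N \<inter> X \<in> null_sets \<mu>" by (intro acim_null_sets[OF ac X]) auto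
    then show "N \<in> null_sets ?\<nu>"
      using N by (auto simp: null_sets_distr_iff[OF m\<psi>] acim_space[OF ac X])
  qed
  then show ?thesis
    unfolding acim_def using inv mT prob_space.prob_space_distr[OF mS(3) m\<psi>] by simp
qed

section \<open>Full branches of the iterated greedy map\<close>

text \<open>
  The parameters are called \<open>a\<close> and \<open>b\<close> because the locale is instantiated both with
  \<open>(q0, q1)\<close> and, for the lazy map, with \<open>(q1, q0)\<close>.
\<close>

locale greedy_system =
  fixes a b :: real
  assumes a: "a > 1" and b: "b > 1" and ab: "a * b \<le> a + b"
begin

abbreviation "T \<equiv> greedy a b"
abbreviation "r \<equiv> r_Q a b"
abbreviation "e \<equiv> 1 / (b - 1)"

lemma r_pos: "0 < r" and c_less_r: "1 / b < r" and r_le_e: "r \<le> e"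
  using a b ab by (auto simp: r_Q_def field_simps)

lemma T_left: "x < 1 / b \<Longrightarrow> T x = a * x"
  and T_right: "1 / b \<le> x \<Longrightarrow> T x = b * x - 1"
  by (simp_all add: greedy_def)

lemma T_core: assumes "0 \<le> x" "x < r" shows "0 \<le> T x" "T x < r"
proof -
  show "0 \<le> T x" using assms a b by (auto simp: greedy_def field_simps)
  show "T x < r"
  proof (cases "x < 1 / b")
    case True
    then have "a * x < a * (1 / b)" using a by (intro mult_strict_left_mono) auto
    then show ?thesis using True by (simp add: greedy_def r_Q_def)
  next
    case False
    have "b * x < a" using assms(2) b by (simp add: r_Q_def field_simps)
    moreover have "a - 1 \<le> a / b" using a b ab by (simp add: field_simps)
    ultimately show ?thesis using False by (simp add: greedy_def r_Q_def)
  qed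
qed

lemma funpow_T_core: assumes "0 \<le> x" "x < r" shows "0 \<le> (T ^^ n) x \<and> (T ^^ n) x < r"
  using assms by (induction n) (auto simp: T_core)

lemma measurable_T[measurable]: "T \<in> borel_measurable borel"
  unfolding greedy_def[abs_def] by measurable

text \<open>
  While the image \<open>[0, \<epsilon>)\<close> stays to the left of \<open>1 / b\<close>, one more step multiplies it by \<open>a\<close>. The first
  image that reaches \<open>1 / b\<close> has length less than \<open>a * (1 / b) = r\<close>, unless it is the initial one.
\<close>

lemma branch_grows:
  assumes "z < w" "0 < s" "s * (w - z) \<le> r"
    and br: "\<forall>t\<in>{z..<w}. (T ^^ n) t = s * (t - z)"
  shows "\<exists>n s. 0 < s \<and> 1 / b \<le> s * (w - z) \<and> s * (w - z) \<le> r \<and> (\<forall>t\<in>{z..<w}. (T ^^ n) t = s * (t - z))"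
proof -
  have pos: "0 < s * (w - z)" using assms by simp
  obtain k0 where "1 / b / (s * (w - z)) < a ^ k0"
    using real_arch_pow[OF a] by blast
  then have ex: "1 / b \<le> a ^ k0 * (s * (w - z))"
    using pos_divide_less_eq[OF pos, of "1 / b" "a ^ k0"] by linarith
  define k where "k = (LEAST k. 1 / b \<le> a ^ k * (s * (w - z)))"
  have k: "1 / b \<le> a ^ k * (s * (w - z))"
    unfolding k_def by (rule LeastI[where P = "\<lambda>k. 1 / b \<le> a ^ k * (s * (w - z))", OF ex])
  have less: "a ^ j * (s * (w - z)) < 1 / b" if "j < k" for j
    using not_less_Least[where P = "\<lambda>k. 1 / b \<le> a ^ k * (s * (w - z))"] that
    unfolding k_def by fastforce
  have up: "a ^ k * (s * (w - z)) \<le> r"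
  proof (cases k)
    case (Suc j)
    have "a * (a ^ j * (s * (w - z))) \<le> a * (1 / b)"
      using less[of j] Suc a by (intro mult_left_mono) auto
    then show ?thesis by (simp add: Suc r_Q_def mult.assoc)
  qed (use assms in simp)
  have "(T ^^ (j + n)) t = a ^ j * s * (t - z)" if "j \<le> k" "t \<in> {z..<w}" for j t
    using that
  proof (induction j)
    case (Suc j)
    have "a ^ j * (s * (t - z)) \<le> a ^ j * (s * (w - z))"
      using Suc.prems assms a by (intro mult_left_mono) auto
    also have "\<dots> < 1 / b" using less Suc.prems by auto
    finally have "(T ^^ (j + n)) t < 1 / b" using Suc by (simp add: mult.assoc)
    then show ?case using Suc by (simp add: T_left)
  qed (use br in simp)
  moreover have "0 < a ^ k * s" using a assms by simp
  ultimately show ?thesis using k up by (intro exI[of _ "k + n"] exI[of _ "a ^ k * s"]) (simp add: mult.assoc)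
qed

text \<open>
  The interval \<open>[z, w)\<close> arises from the first cut, at \<open>1 / b\<close>, between the iterates of \<open>x\<close> and \<open>y\<close>: its
  left endpoint \<open>z\<close> is the point sent to the cut, hence to \<open>0\<close> one step later. Because each branch of
  the greedy map is closed on the left, the common affine branch at \<open>x\<close> and \<open>y\<close> always extends a little
  to the right of \<open>y\<close>, so that \<open>w > y\<close> can be chosen and no exceptional points occur.
\<close>

lemma full_branch:
  assumes "0 \<le> x" "x < y" "y < w0" "w0 \<le> r"
  shows "\<exists>z w n s. x < z \<and> z \<le> y \<and> y < w \<and> w \<le> w0 \<and> 0 < s
    \<and> 1 / b \<le> s * (w - z) \<and> s * (w - z) \<le> r \<and> (\<forall>t\<in>{z..<w}. (T ^^ n) t = s * (t - z))"
proof -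
  define l where "l = min a b"
  have l: "1 < l" "l \<le> a" "l \<le> b" using a b by (auto simp: l_def)
  define P where "P n w s \<longleftrightarrow> y < w \<and> w \<le> w0 \<and> l ^ n \<le> s
    \<and> (\<forall>t\<in>{x..<w}. (T ^^ n) t = (T ^^ n) x + s * (t - x))" for n w s
  \<comment> \<open>\<open>P n w s\<close>: no cut has occurred before time \<open>n\<close>, and \<open>w\<close> bounds the common branch. The growing
    slope forbids this for all \<open>n\<close>; the last such \<open>n\<close> is the time of the cut.\<close>
  have spos: "0 < s" if "P n w s" for n w s
    using that l by (auto simp: P_def intro: less_le_trans[of 0 "l ^ n"])
  have iter_y: "(T ^^ n) y = (T ^^ n) x + s * (y - x)" if "P n w s" for n w s
  proof -
    have "y \<in> {x..<w}" using that assms(2) by (simp add: P_def)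
    then show ?thesis using that unfolding P_def by blast
  qed
  have P0: "P 0 w0 1" using assms by (auto simp: P_def)
  have "\<not> (\<forall>n. \<exists>w s. P n w s)"
  proof
    assume all: "\<forall>n. \<exists>w s. P n w s"
    obtain n where n: "r / (y - x) < l ^ n" using real_arch_pow[OF l(1)] by blast
    obtain w s where p: "P n w s" using all by blast
    have "l ^ n \<le> s" using p unfolding P_def by blast
    have "r < l ^ n * (y - x)" using n assms(2) by (simp add: field_simps)
    also have "\<dots> \<le> s * (y - x)" using \<open>l ^ n \<le> s\<close> assms(2) by (simp add: mult_right_mono)
    also have "\<dots> \<le> (T ^^ n) y"
      using iter_y[OF p] funpow_T_core[of x n] assms by auto
    finally show False using funpow_T_core[of y n] assms by auto
  qed
  then obtain n where n: "\<exists>w s. P n w s" "\<not> (\<exists>w s. P (Suc n) w s)"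
    using P0 nat_induct[of "\<lambda>n. \<exists>w s. P n w s"] by blast
  then obtain w s where p: "P n w s" by blast
  note s = spos[OF p] and ynx = iter_y[OF p]
  have wy: "y < w" "w \<le> w0" "l ^ n \<le> s"
    and lin: "\<And>t. t \<in> {x..<w} \<Longrightarrow> (T ^^ n) t = (T ^^ n) x + s * (t - x)"
    using p unfolding P_def by blast+
  have mono: "(T ^^ n) x \<le> (T ^^ n) t" if "t \<in> {x..<w}" for t
    using lin[OF that] mult_nonneg_nonneg[of s "t - x"] s that by simp
  have cut1: "(T ^^ n) x < 1 / b"
  proof (rule ccontr)
    assume right: "\<not> ?thesis"
    have "P (Suc n) w (b * s)"
      unfolding P_def
    proof (intro conjI ballI)
      show "l ^ Suc n \<le> b * s" using l wy by (auto intro!: mult_mono)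
      fix t assume t: "t \<in> {x..<w}"
      have "T ((T ^^ n) t) = b * (T ^^ n) t - 1" "T ((T ^^ n) x) = b * (T ^^ n) x - 1"
        using right mono[OF t] by (auto intro!: T_right)
      then show "(T ^^ Suc n) t = (T ^^ Suc n) x + b * s * (t - x)"
        unfolding funpow.simps o_apply lin[OF t] by (simp add: algebra_simps)
    qed (use wy in auto)
    then show False using n(2) by blast
  qed
  have cut2: "1 / b \<le> (T ^^ n) y"
  proof (rule ccontr)
    assume left: "\<not> ?thesis"
    define w' where "w' = min w (y + (1 / b - (T ^^ n) y) / s)"
    have "P (Suc n) w' (a * s)"
      unfolding P_def
    proof (intro conjI ballI)
      show "y < w'" "w' \<le> w0" using wy left s by (auto simp: w'_def)
      show "l ^ Suc n \<le> a * s" using l wy by (auto intro!: mult_mono)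
      fix t assume t: "t \<in> {x..<w'}"
      then have tw: "t \<in> {x..<w}" by (auto simp: w'_def)
      have "t - y < (1 / b - (T ^^ n) y) / s" using t by (auto simp: w'_def)
      then have "s * (t - y) < 1 / b - (T ^^ n) y" using s by (simp add: pos_less_divide_eq mult.commute)
      moreover have "(T ^^ n) t = (T ^^ n) y + s * (t - y)"
        using lin[OF tw] ynx by (simp add: algebra_simps)
      ultimately have "(T ^^ n) t < 1 / b" by linarith
      then have "T ((T ^^ n) t) = a * (T ^^ n) t" "T ((T ^^ n) x) = a * (T ^^ n) x"
        using cut1 by (auto intro!: T_left)
      then show "(T ^^ Suc n) t = (T ^^ Suc n) x + a * s * (t - x)"
        unfolding funpow.simps o_apply lin[OF tw] by (simp add: algebra_simps)
    qed
    then show False using n(2) by blast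
  qed
  define z where "z = x + (1 / b - (T ^^ n) x) / s"
  have sz: "s * (z - x) = 1 / b - (T ^^ n) x" using s by (simp add: z_def)
  have xz: "x < z" using cut1 s by (simp add: z_def)
  have "s * (z - x) \<le> s * (y - x)" using sz ynx cut2 by linarith
  then have zy: "z \<le> y" using s by simp
  have br: "(T ^^ Suc n) t = (b * s) * (t - z)" if "t \<in> {z..<w}" for t
  proof -
    have tw: "t \<in> {x..<w}" using that xz by auto
    have eq: "(T ^^ n) t = 1 / b + s * (t - z)"
      using lin[OF tw] sz by (simp add: algebra_simps)
    moreover have "0 \<le> s * (t - z)" using s that by auto
    ultimately have "T ((T ^^ n) t) = b * (1 / b + s * (t - z)) - 1"
      by (simp add: T_right)
    then show ?thesis using b by (simp add: distrib_left)
  qed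
  \<comment> \<open>Shortening \<open>[z, w)\<close> keeps its image within \<open>[0, r)\<close>; the image of \<open>y\<close> is below \<open>r\<close>, so \<open>y\<close> is not lost.\<close>
  define w1 where "w1 = min w (z + r / (b * s))"
  have bs: "0 < b * s" using b s by simp
  have "(b * s) * (y - z) < r"
    using br[of y] zy wy funpow_T_core[of y "Suc n"] assms by auto
  then have "y - z < r / (b * s)" using bs by (simp only: pos_less_divide_eq mult.commute)
  then have yw1: "y < w1" using wy by (simp add: w1_def)
  have "w1 - z \<le> r / (b * s)" by (simp add: w1_def)
  then have up: "(b * s) * (w1 - z) \<le> r" using bs by (simp only: pos_le_divide_eq mult.commute)
  have "\<exists>n s. 0 < s \<and> 1 / b \<le> s * (w1 - z) \<and> s * (w1 - z) \<le> r \<and> (\<forall>t\<in>{z..<w1}. (T ^^ n) t = s * (t - z))"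
  proof (rule branch_grows[OF _ bs up])
    show "z < w1" using zy yw1 by simp
    show "\<forall>t\<in>{z..<w1}. (T ^^ Suc n) t = b * s * (t - z)"
      using br by (auto simp: w1_def)
  qed
  then obtain n' s' where "0 < s'" "1 / b \<le> s' * (w1 - z)" "s' * (w1 - z) \<le> r"
    "\<forall>t\<in>{z..<w1}. (T ^^ n') t = s' * (t - z)" by blast
  moreover have "w1 \<le> w0" using wy by (simp add: w1_def)
  ultimately show ?thesis using xz zy yw1 by blast
qed

text \<open>
  Every full branch pulls the part \<open>B0\<close> of \<open>B\<close> in \<open>[0, 1 / b)\<close> back into \<open>B\<close>. It does so affinely, from an image
  of length at most \<open>r\<close>, which gives \<open>B\<close> the density \<open>\<beta> / r\<close> in the branch, \<open>\<beta>\<close> being the measure of \<open>B0\<close>.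
  That \<open>\<beta>\<close> is positive follows because the left branch maps \<open>[0, 1 / b)\<close> onto \<open>[0, r)\<close>.
\<close>

lemma strongly_ergodic:
  assumes [measurable]: "B \<in> sets borel"
    and inv: "\<And>t. t \<in> {0..<r} \<Longrightarrow> T t \<in> B \<Longrightarrow> t \<in> B"
    and pos: "B \<inter> {0..<r} \<notin> null_sets lborel"
  shows "{0..<r} - B \<in> null_sets lborel"
proof -
  have invn: "t \<in> B" if "t \<in> {0..<r}" "(T ^^ n) t \<in> B" for t n
    using that(2)
  proof (induction n)
    case (Suc n)
    show ?case using Suc inv[of "(T ^^ n) t"] funpow_T_core[of t n] that(1) by auto
  qed simp
  define B0 where "B0 = B \<inter> {0..<1/b}"
  have [measurable]: "B0 \<in> sets borel" by (simp add: B0_def)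
  have B0pos: "emeasure lborel B0 \<noteq> 0"
  proof
    assume "emeasure lborel B0 = 0"
    moreover have "{t. a * (t - 0) \<in> B \<inter> {0..<r}} \<subseteq> B0"
    proof
      fix t assume t: "t \<in> {t. a * (t - 0) \<in> B \<inter> {0..<r}}"
      then have "0 \<le> t" "t < 1 / b" using a b by (auto simp: r_Q_def field_simps zero_le_mult_iff)
      moreover have "T t \<in> B" using t \<open>t < 1 / b\<close> by (simp add: greedy_def)
      ultimately show "t \<in> B0" using inv[of t] c_less_r by (auto simp: B0_def)
    qed
    ultimately have "emeasure lborel {t. a * (t - 0) \<in> B \<inter> {0..<r}} = 0"
      by (metis (no_types, lifting) emeasure_mono \<open>B0 \<in> sets borel\<close> sets_lborel le_zero_eq)
    then have "emeasure lborel (B \<inter> {0..<r}) = 0"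
      using a by (subst (asm) emeasure_lborel_affine_preimage) auto
    then show False using pos by (auto simp: null_sets_def)
  qed
  have "emeasure lborel B0 \<le> emeasure lborel {0..<1/b}"
    by (rule emeasure_mono) (auto simp: B0_def)
  then have "emeasure lborel B0 < \<infinity>" using b by (auto simp: less_top[symmetric] top_unique)
  then obtain \<beta> where \<beta>: "emeasure lborel B0 = ennreal \<beta>" "0 < \<beta>"
    using B0pos by (cases "emeasure lborel B0") (auto simp: less_le)
  have "{0<..<r} - B \<in> null_sets lborel"
  proof (rule null_set_if_disjoint_positive_density[of _ B "\<beta> / r"])
    show "0 < \<beta> / r" using \<beta> r_pos by simp
    fix x d :: real assume x: "x \<in> {0<..<r} - B" and d: "0 < d"
    define x0 where "x0 = max 0 (x - d / 3)"
    define w0 where "w0 = min r (x + d / 3)"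
    have le: "0 \<le> x0" "x0 < x" "x < w0" "w0 \<le> r" using x d by (auto simp: x0_def w0_def)
    obtain z w n s where br: "x0 < z" "z \<le> x" "x < w" "w \<le> w0" "0 < s"
      "1 / b \<le> s * (w - z)" "s * (w - z) \<le> r" "\<forall>t\<in>{z..<w}. (T ^^ n) t = s * (t - z)"
      using full_branch[OF le] by blast
    have sub: "{t. s * (t - z) \<in> B0} \<subseteq> B \<inter> {z..w}"
    proof
      fix t assume t: "t \<in> {t. s * (t - z) \<in> B0}"
      then have tz: "z \<le> t" using br(5) by (auto simp: B0_def zero_le_mult_iff)
      have "s * (t - z) < s * (w - z)" using t br(6) by (auto simp: B0_def)
      then have tw: "t < w" using br(5) by simp
      have "(T ^^ n) t \<in> B" using br(8) t tz tw by (auto simp: B0_def)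
      then have "t \<in> B" using invn[of t n] tz tw br le by auto
      then show "t \<in> B \<inter> {z..w}" using tz tw by auto
    qed
    have "\<beta> / r * (w - z) \<le> 1 / s * \<beta>"
      using mult_left_mono[OF br(7), of \<beta>] br(5) r_pos \<beta>(2)
      by (simp add: divide_simps mult.commute mult.left_commute)
    then have "ennreal (\<beta> / r * (w - z)) \<le> ennreal (1 / s) * emeasure lborel B0"
      unfolding \<beta>(1) using br(5) \<beta>(2) by (subst ennreal_mult'[symmetric]) (auto intro!: ennreal_leI)
    also have "\<dots> = emeasure lborel {t. s * (t - z) \<in> B0}"
      using br(5) by (simp add: emeasure_lborel_affine_preimage)
    also have "\<dots> \<le> emeasure lborel (B \<inter> {z..w})"
      by (rule emeasure_mono[OF sub]) simp
    finally show "\<exists>u w. u < w \<and> x \<in> {u..w} \<and> w - u < d \<and>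
      ennreal (\<beta> / r * (w - u)) \<le> emeasure lborel (B \<inter> {u..w})"
      using br le d by (intro exI[of _ z] exI[of _ w]) (auto simp: x0_def w0_def)
  qed auto
  moreover have "{0::real} \<in> null_sets lborel" by (simp add: finite_imp_null_set_lborel)
  ultimately have "({0<..<r} - B) \<union> {0} \<in> null_sets lborel" by (rule null_sets.Un)
  then show ?thesis by (rule null_sets_subset) auto
qed

section \<open>Invariant measures of the greedy map\<close>

lemma T_maps_I: "T ` I_Q a b \<subseteq> I_Q a b"
proof
  fix u assume "u \<in> T ` I_Q a b"
  then obtain x where x: "0 \<le> x" "x \<le> e" "u = T x" by (auto simp: I_Q_def)
  show "u \<in> I_Q a b"
  proof (cases "x < 1 / b")
    case True
    then show ?thesis using T_core[of x] x c_less_r r_le_e by (auto simp: I_Q_def)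
  next
    case False
    have "b * x \<le> b * e" using x b by (intro mult_left_mono) auto
    also have "b * e = 1 + e" using b by (simp add: field_simps)
    finally have "b * x - 1 \<le> e" by simp
    moreover have "1 \<le> b * x" using False b by (simp add: field_simps)
    ultimately show ?thesis using False x by (auto simp: I_Q_def T_right)
  qed
qed

text \<open>
  The left branch does not reach \<open>r\<close>, and the right one expands by \<open>b\<close> about its fixed point \<open>e\<close>.
\<close>

lemma preimage_right_end:
  assumes "0 \<le> t" "t \<le> e - r"
  shows "T -` {e - t..e} \<inter> I_Q a b = {e - t / b..e}"
proof -
  have be: "b * e = 1 + e" using b by (simp add: field_simps)
  have mem: "b * x - 1 \<in> {e - t..e} \<longleftrightarrow> x \<in> {e - t / b..e}" for x
  proof -
    have "e - t \<le> b * x - 1 \<longleftrightarrow> b * (e - t / b) \<le> b * x"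
      using b be by (simp add: right_diff_distrib) linarith
    moreover have "b * x - 1 \<le> e \<longleftrightarrow> b * x \<le> b * e" using be by linarith
    ultimately show ?thesis
      using b by (simp only: atLeastAtMost_iff mult_le_cancel_left_pos[of b])
  qed
  have left: "1 / b \<le> x" if "x \<in> {e - t / b..e}" for x
  proof -
    have "0 \<le> b * x - 1" using mem[of x] that assms r_pos by auto
    then show ?thesis using b by (simp add: field_simps)
  qed
  show ?thesis
  proof (intro set_eqI iffI)
    fix x assume x: "x \<in> T -` {e - t..e} \<inter> I_Q a b"
    have "1 / b \<le> x"
    proof (rule ccontr)
      assume c: "\<not> 1 / b \<le> x"
      have "T x = a * x" using c by (simp add: T_left)
      moreover have "a * x < a * (1 / b)" using c a by (intro mult_strict_left_mono) auto
      ultimately have "T x < r" by (simp add: r_Q_def)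
      then show False using x assms by auto
    qed
    then show "x \<in> {e - t / b..e}" using x mem[of x] by (simp add: T_right)
  next
    fix x assume x: "x \<in> {e - t / b..e}"
    have "0 \<le> x" using left[OF x] b by (intro order_trans[OF _ left[OF x]]) simp
    then show "x \<in> T -` {e - t..e} \<inter> I_Q a b"
      using x left[OF x] mem[of x] by (auto simp: T_right I_Q_def)
  qed
qed

text \<open>
  By invariance all the preimages \<open>E n\<close> of \<open>[r, e]\<close> have the same mass, and they shrink to \<open>{e}\<close>.
\<close>

lemma acim_vanishes_outside:
  assumes ac: "acim (I_Q a b) T \<mu>"
  shows "emeasure \<mu> {r..e} = 0"
proof -
  have fin: "finite_measure \<mu>"
    using ac by (simp add: acim_def prob_space_def)
  define d where "d = e - r"
  have d: "0 \<le> d" using r_le_e by (simp add: d_def)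
  define E where "E n = {e - d / b ^ n..e}" for n :: nat
  have dn: "0 \<le> d / b ^ n" "d / b ^ n \<le> d" for n
  proof -
    have "1 \<le> b ^ n" using b by simp
    then show "d / b ^ n \<le> d" using divide_left_mono[of 1 "b ^ n" d] d b by simp
  qed (use d b in simp)
  have I: "I_Q a b \<in> sets borel" by (simp add: I_Q_def)
  have Es: "E n \<in> sets \<mu>" for n
  proof -
    have "0 \<le> e - d / b ^ n" using dn(2)[of n] r_pos unfolding d_def by linarith
    then have "E n \<subseteq> I_Q a b" unfolding E_def I_Q_def by (intro atLeastatMost_subset_iff[THEN iffD2]) simp
    then show ?thesis unfolding acim_sets_iff[OF ac I] by (simp add: E_def)
  qed
  have const: "emeasure \<mu> (E n) = emeasure \<mu> (E 0)" for n
  proof (induction n)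
    case (Suc n)
    have "T -` E n \<inter> I_Q a b = E (Suc n)"
      using preimage_right_end[OF dn[of n, unfolded d_def]]
      unfolding E_def d_def by (simp only: power_Suc2 divide_divide_eq_left)
    then show ?case using acim_invariant[OF ac I Es[of n]] Suc by (simp only:)
  qed simp
  have mono: "E (Suc n) \<subseteq> E n" for n
  proof -
    have "b ^ n \<le> b ^ Suc n" using b by (intro power_increasing) auto
    then have "d / b ^ Suc n \<le> d / b ^ n" using d b by (intro divide_left_mono) auto
    then show ?thesis unfolding E_def by (intro atLeastatMost_subset_iff[THEN iffD2]) simp
  qed
  have "(\<Inter>n. E n) = {e}"
  proof (intro set_eqI iffI)
    fix x assume x: "x \<in> (\<Inter>n. E n)"
    have "(\<lambda>n. e - d / b ^ n) \<longlonglongrightarrow> e - 0"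
      using b by (intro tendsto_diff tendsto_const) (rule LIMSEQ_divide_realpow_zero)
    moreover have "e - d / b ^ n \<le> x" for n
      using x unfolding E_def by (meson INT_D UNIV_I atLeastAtMost_iff)
    ultimately have "e - 0 \<le> x"
      by (intro LIMSEQ_le_const2[of "\<lambda>n. e - d / b ^ n"]) auto
    moreover have "x \<le> e" using x unfolding E_def by (meson INT_D UNIV_I atLeastAtMost_iff)
    ultimately show "x \<in> {e}" by simp
  next
    fix x assume "x \<in> {e}"
    then show "x \<in> (\<Inter>n. E n)" using dn(1) unfolding E_def by simp
  qed
  moreover have "{e} \<in> null_sets \<mu>"
    using b by (intro acim_null_sets[OF ac]) (auto simp: I_Q_def finite_imp_null_set_lborel)
  ultimately have "emeasure \<mu> (\<Inter>n. E n) = 0" by (simp only: null_setsD1)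
  moreover have "(\<lambda>n. emeasure \<mu> (E n)) \<longlonglongrightarrow> emeasure \<mu> (\<Inter>n. E n)"
    using Es mono by (intro Lim_emeasure_decseq decseq_SucI)
      (auto simp: finite_measure.emeasure_finite[OF fin])
  moreover have "(\<lambda>n. emeasure \<mu> (E n)) = (\<lambda>_. emeasure \<mu> (E 0))"
    using const by (rule ext)
  ultimately have "emeasure \<mu> (E 0) = 0"
    by (simp only: LIMSEQ_const_iff)
  then show ?thesis by (simp add: E_def d_def)
qed

lemma acim_equivalent_lborel:
  assumes ac: "acim (I_Q a b) T \<mu>"
  shows "equivalent_on {0..<r} \<mu> (leb_on (I_Q a b))"
  unfolding equivalent_on_def
proof (intro allI impI iffI)
  have I: "I_Q a b \<in> sets borel" by (simp add: I_Q_def)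
  have sub: "{0..<r} \<subseteq> I_Q a b" using r_le_e by (auto simp: I_Q_def)
  fix A assume A: "A \<subseteq> {0..<r}"
  show "A \<in> null_sets \<mu>" if "A \<in> null_sets (leb_on (I_Q a b))"
    using that ac by (auto simp: acim_def absolutely_continuous_def)
  assume null: "A \<in> null_sets \<mu>"
  then have [measurable]: "A \<in> sets borel" using acim_sets_iff[OF ac I] by (auto simp: null_sets_def)
  have Tn[measurable]: "(T ^^ n) \<in> borel_measurable borel" for n
    by (rule measurable_compose_n) (rule measurable_T)
  have pre: "(T ^^ n) -` A \<inter> I_Q a b \<in> null_sets \<mu>" for n
  proof (induction n)
    case 0
    then show ?case using null A sub by (simp add: Int_absorb2)
  next
    case (Suc n)
    have eq: "(T ^^ Suc n) -` A \<inter> I_Q a b = T -` ((T ^^ n) -` A \<inter> I_Q a b) \<inter> I_Q a b"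
      using T_maps_I by (auto simp: funpow_swap1)
    have "emeasure \<mu> ((T ^^ Suc n) -` A \<inter> I_Q a b) = 0"
      unfolding eq using acim_invariant[OF ac I null_setsD2[OF Suc]] null_setsD1[OF Suc] by (rule trans)
    moreover have "(T ^^ Suc n) -` A \<inter> I_Q a b \<in> sets \<mu>"
      unfolding acim_sets_iff[OF ac I] using measurable_sets_borel[OF Tn[of "Suc n"], of A] I
      by (intro conjI sets.Int) auto
    ultimately show ?case by (rule null_setsI)
  qed
  define B where "B = (\<Union>n. (T ^^ n) -` A \<inter> {0..<r})"
  have B[measurable]: "B \<in> sets borel"
    unfolding B_def using measurable_sets_borel[OF Tn] by auto
  have Bnull: "B \<in> null_sets \<mu>"
  proof (rule null_sets_subset[OF null_sets_UN[of _ \<mu>], of "\<lambda>n. (T ^^ n) -` A \<inter> I_Q a b"])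
    show "B \<subseteq> (\<Union>n. (T ^^ n) -` A \<inter> I_Q a b)" using sub by (auto simp: B_def)
    show "B \<in> sets \<mu>" using B sub by (auto simp: acim_sets_iff[OF ac I] B_def)
  qed (rule pre)
  have "A \<in> null_sets lborel"
  proof (rule ccontr)
    assume pos: "A \<notin> null_sets lborel"
    have AB: "A \<subseteq> B \<inter> {0..<r}"
    proof
      fix x assume "x \<in> A"
      then have "x \<in> (T ^^ 0) -` A \<inter> {0..<r}" using A by auto
      then show "x \<in> B \<inter> {0..<r}" unfolding B_def by blast
    qed
    have "{0..<r} - B \<in> null_sets lborel"
    proof (rule strongly_ergodic[OF B])
      fix t assume t: "t \<in> {0..<r}" "T t \<in> B"
      then obtain n where "(T ^^ n) (T t) \<in> A" by (auto simp: B_def)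
      then have "t \<in> (T ^^ Suc n) -` A \<inter> {0..<r}" using t by (simp add: funpow_swap1)
      then show "t \<in> B" unfolding B_def by blast
    next
      show "B \<inter> {0..<r} \<notin> null_sets lborel"
        using AB pos null_sets_subset[of _ lborel A] by auto
    qed
    then have "{0..<r} - B \<in> null_sets \<mu>"
      using sub by (intro acim_null_sets[OF ac I]) auto
    moreover have "{r..e} \<in> null_sets \<mu>"
      using acim_vanishes_outside[OF ac] r_pos
      by (auto simp: null_sets_def acim_sets_iff[OF ac I] I_Q_def)
    ultimately have "B \<union> ({0..<r} - B) \<union> {r..e} \<in> null_sets \<mu>"
      using Bnull by (intro null_sets.Un)
    moreover have "B \<union> ({0..<r} - B) \<union> {r..e} = space \<mu>"
      using r_pos r_le_e by (auto simp: acim_space[OF ac I] B_def I_Q_def)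
    ultimately show False
      using ac prob_space.emeasure_space_1[of \<mu>] by (auto simp: acim_def null_sets_def)
  qed
  then show "A \<in> null_sets (leb_on (I_Q a b))"
    using A sub I by (auto simp: null_sets_restrict_space)
qed

end

section \<open>Conjugacy between lazy and greedy maps\<close>

text \<open>
  This is the decreasing affine bijection of \<^term>\<open>I_Q a b\<close> onto \<^term>\<open>I_Q b a\<close>.
\<close>

definition flip :: "real \<Rightarrow> real \<Rightarrow> real \<Rightarrow> real" where
  "flip a b x = (1 - (b - 1) * x) / (a - 1)"

lemma flip_flip: assumes "a > 1" "b > 1" shows "flip b a (flip a b x) = x"
  using assms by (simp add: flip_def)

lemma measurable_flip[measurable]: "flip a b \<in> borel_measurable borel"
  unfolding flip_def[abs_def] by measurable

lemma flip_le_iff: assumes "a > 1" "b > 1" shows "flip a b x \<le> flip a b y \<longleftrightarrow> y \<le> x"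
  using assms by (simp add: flip_def divide_le_cancel mult_le_cancel_left)

lemma flip_less_iff: assumes "a > 1" "b > 1" shows "flip a b x < flip a b y \<longleftrightarrow> y < x"
  using assms by (simp add: flip_le_iff flip: not_le)

lemma flip_ends: assumes "a > 1" "b > 1"
  shows "flip a b 0 = 1 / (a - 1)" "flip a b (1 / (b - 1)) = 0"
    "flip a b (l_Q a b) = r_Q b a" "flip a b (1 / (a * (b - 1))) = 1 / a"
proof -
  have "b - b / a = b / a * (a - 1)" using assms by (simp add: field_simps)
  moreover have "(b - 1) * l_Q a b = b / a - (b - 1)"
  proof -
    have "(b - 1) * (b / (a * (b - 1))) = b / a" using assms by simp
    then show ?thesis unfolding l_Q_def by (simp only: right_diff_distrib mult_1_right)
  qed
  ultimately show "flip a b (l_Q a b) = r_Q b a"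
    using assms by (simp add: flip_def r_Q_def)
  have "1 - 1 / a = 1 / a * (a - 1)" using assms by (simp add: field_simps)
  then show "flip a b (1 / (a * (b - 1))) = 1 / a"
    using assms by (simp add: flip_def)
qed (use assms in \<open>simp_all add: flip_def\<close>)

lemma flip_mem_I: assumes "a > 1" "b > 1" shows "flip a b x \<in> I_Q b a \<longleftrightarrow> x \<in> I_Q a b"
  using flip_le_iff[OF assms, of x 0] flip_le_iff[OF assms, of "1 / (b - 1)" x] flip_ends[OF assms]
  by (auto simp: I_Q_def)

text \<open>
  The flip exchanges the fixed points \<open>0\<close> and \<open>1 / (b - 1)\<close>, and with them the branches of slope \<open>a\<close> and
  \<open>b\<close>. It sends the switching point of the lazy map to that of the greedy map, and reversing the order
  turns the left-closed branches of the latter into the right-closed ones of the former.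
\<close>

lemma flip_lazy:
  assumes "a > 1" "b > 1"
  shows "flip a b (lazy a b x) = greedy b a (flip a b x)"
proof -
  have "x \<le> 1 / (a * (b - 1)) \<longleftrightarrow> 1 / a \<le> flip a b x"
    using flip_le_iff[OF assms, of "1 / (a * (b - 1))" x] flip_ends[OF assms] by simp
  moreover have "flip a b (a * x) = a * flip a b x - 1"
  proof -
    have "1 - (b - 1) * (a * x) = a * (1 - (b - 1) * x) - (a - 1)" by (simp add: algebra_simps)
    then have "flip a b (a * x) = a * (1 - (b - 1) * x) / (a - 1) - (a - 1) / (a - 1)"
      by (simp only: flip_def diff_divide_distrib)
    then show ?thesis using assms by (simp add: flip_def)
  qed
  moreover have "flip a b (b * x - 1) = b * flip a b x"
    by (simp add: flip_def algebra_simps)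
  ultimately show ?thesis by (auto simp: lazy_def greedy_def)
qed

lemma flip_null_sets:
  assumes "a > 1" "b > 1" and [measurable]: "A \<in> sets borel"
  shows "flip a b -` A \<in> null_sets lborel \<longleftrightarrow> A \<in> null_sets lborel"
proof -
  have "emeasure lborel (flip a b -` A) = ennreal \<bar>1 / - ((b - 1) / (a - 1))\<bar> * emeasure lborel A"
  proof -
    have "flip a b x = - ((b - 1) / (a - 1)) * (x - 1 / (b - 1))" for x
    proof -
      have "(b - 1) * (x - 1 / (b - 1)) = (b - 1) * x - 1"
        using assms nonzero_mult_div_cancel_left[of "b - 1" 1] by (simp only: right_diff_distrib) simp
      moreover have "- ((b - 1) / (a - 1)) * y = - ((b - 1) * y) / (a - 1)" for y by simp
      ultimately have "- ((b - 1) / (a - 1)) * (x - 1 / (b - 1)) = - ((b - 1) * x - 1) / (a - 1)"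
        by (simp only:)
      then show ?thesis by (simp only: flip_def minus_diff_eq)
    qed
    then have "flip a b -` A = {t. - ((b - 1) / (a - 1)) * (t - 1 / (b - 1)) \<in> A}" by auto
    then show ?thesis
      using assms by (simp only:) (intro emeasure_lborel_affine_preimage, auto)
  qed
  then show ?thesis using assms measurable_sets_borel[OF measurable_flip, of A a b]
    by (auto simp: null_sets_def)
qed

theorem theorem1p2:
  fixes q0 q1 :: real
  assumes "q0 > 1" and "q1 > 1" and "q0 + q1 \<ge> q0 * q1"
  shows "(\<forall>\<mu>g. acim (I_Q q0 q1) (greedy q0 q1) \<mu>g \<longrightarrow>
            equivalent_on {0..<r_Q q0 q1} \<mu>g (leb_on (I_Q q0 q1)) \<and>
            emeasure \<mu>g (I_Q q0 q1 - {0..<r_Q q0 q1}) = 0) \<and>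
         (\<forall>\<mu>l. acim (I_Q q0 q1) (lazy q0 q1) \<mu>l \<longrightarrow>
            equivalent_on {l_Q q0 q1<..1 / (q1 - 1)} \<mu>l (leb_on (I_Q q0 q1)) \<and>
            emeasure \<mu>l (I_Q q0 q1 - {l_Q q0 q1<..1 / (q1 - 1)}) = 0)"
proof (intro conjI allI impI)
  interpret g: greedy_system q0 q1 using assms by unfold_locales auto
  interpret f: greedy_system q1 q0 using assms by unfold_locales (auto simp: ac_simps)
  have I[measurable]: "I_Q x y \<in> sets borel" for x y by (simp add: I_Q_def)
  fix \<mu>
  {
    assume ac: "acim (I_Q q0 q1) (greedy q0 q1) \<mu>"
    show "equivalent_on {0..<r_Q q0 q1} \<mu> (leb_on (I_Q q0 q1))"
      by (rule g.acim_equivalent_lborel[OF ac])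
    have "I_Q q0 q1 - {0..<r_Q q0 q1} = {r_Q q0 q1..1 / (q1 - 1)}"
      using g.r_pos by (auto simp: I_Q_def)
    then show "emeasure \<mu> (I_Q q0 q1 - {0..<r_Q q0 q1}) = 0"
      using g.acim_vanishes_outside[OF ac] by simp
  next
    assume ac: "acim (I_Q q0 q1) (lazy q0 q1) \<mu>"
    note q = assms(1,2)
    note q' = assms(2,1)
    define \<nu> where "\<nu> = distr \<mu> (leb_on (I_Q q1 q0)) (flip q0 q1)"
    have ac': "acim (I_Q q1 q0) (greedy q1 q0) \<nu>"
      unfolding \<nu>_def
    proof (rule acim_distr[OF ac])
      show "flip q0 q1 ` I_Q q0 q1 \<subseteq> I_Q q1 q0" by (auto simp: flip_mem_I[OF q])
      show "flip q0 q1 -` N \<in> null_sets lborel" if "N \<in> null_sets lborel" for N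
        using that by (subst flip_null_sets[OF q]) (auto simp: null_sets_def)
    qed (use f.T_maps_I flip_lazy[OF q] in auto)
    have fm: "flip q0 q1 \<in> measurable \<mu> (leb_on (I_Q q1 q0))"
      by (rule measurable_acim[OF ac]) (auto simp: flip_mem_I[OF q])
    have em: "emeasure \<nu> A = emeasure \<mu> (flip q0 q1 -` A \<inter> I_Q q0 q1)" if "A \<in> sets \<nu>" for A
      using that unfolding \<nu>_def by (subst emeasure_distr[OF fm]) (auto simp: acim_space[OF ac I])
    have core: "flip q0 q1 x \<in> {0..<r_Q q1 q0} \<longleftrightarrow> x \<in> {l_Q q0 q1<..1 / (q1 - 1)}" for x
      using flip_le_iff[OF q, of "1 / (q1 - 1)" x] flip_less_iff[OF q, of x "l_Q q0 q1"] flip_ends[OF q]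
      by auto
    have sub: "{l_Q q0 q1<..1 / (q1 - 1)} \<subseteq> I_Q q0 q1"
    proof
      fix x assume "x \<in> {l_Q q0 q1<..1 / (q1 - 1)}"
      then have "flip q0 q1 x \<in> {0..<r_Q q1 q0}" by (simp only: core)
      then have "flip q0 q1 x \<in> I_Q q1 q0" using f.r_le_e by (simp add: I_Q_def)
      then show "x \<in> I_Q q0 q1" by (simp only: flip_mem_I[OF q])
    qed
    show "equivalent_on {l_Q q0 q1<..1 / (q1 - 1)} \<mu> (leb_on (I_Q q0 q1))"
      unfolding equivalent_on_def
    proof (intro allI impI)
      fix A assume A: "A \<subseteq> {l_Q q0 q1<..1 / (q1 - 1)}"
      show "A \<in> null_sets \<mu> \<longleftrightarrow> A \<in> null_sets (leb_on (I_Q q0 q1))"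
      proof (cases "A \<in> sets borel")
        case False
        then have "A \<notin> null_sets \<mu>" "A \<notin> null_sets lborel"
          using acim_sets_iff[OF ac I] null_setsD2[of A \<mu>] null_setsD2[of A lborel] by auto
        then show ?thesis by (simp add: null_sets_restrict_space)
      next
        case True
        define A' where "A' = flip q1 q0 -` A"
        have A'b: "A' \<in> sets borel" unfolding A'_def using True by (rule measurable_sets_borel[OF measurable_flip])
        have AA': "flip q0 q1 -` A' = A" by (auto simp: A'_def flip_flip[OF q])
        have A'c: "A' \<subseteq> {0..<r_Q q1 q0}"
        proof
          fix x assume "x \<in> A'"
          then have "flip q1 q0 x \<in> {l_Q q0 q1<..1 / (q1 - 1)}" using A by (auto simp: A'_def)
          then show "x \<in> {0..<r_Q q1 q0}" using core[of "flip q1 q0 x"] by (simp add: flip_flip[OF q'])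
        qed
        then have A'I: "A' \<subseteq> I_Q q1 q0" using f.r_le_e by (auto simp: I_Q_def)
        have AI: "A \<subseteq> I_Q q0 q1" using A sub by auto
        have "A \<in> null_sets \<mu> \<longleftrightarrow> A' \<in> null_sets \<nu>"
          using True A'b AI A'I em[of A'] AA'
          by (auto simp: null_sets_def acim_sets_iff[OF ac I] acim_sets_iff[OF ac' I] Int_absorb2)
        also have "\<dots> \<longleftrightarrow> A' \<in> null_sets (leb_on (I_Q q1 q0))"
          using f.acim_equivalent_lborel[OF ac'] A'c by (simp add: equivalent_on_def)
        also have "\<dots> \<longleftrightarrow> A \<in> null_sets lborel"
          using A'I flip_null_sets[OF q' True] by (simp add: null_sets_restrict_space A'_def)
        finally show ?thesis using AI by (simp add: null_sets_restrict_space)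
      qed
    qed
    have "flip q0 q1 -` {r_Q q1 q0..1 / (q0 - 1)} \<inter> I_Q q0 q1 = I_Q q0 q1 - {l_Q q0 q1<..1 / (q1 - 1)}"
    proof (intro set_eqI)
      fix x
      have "flip q0 q1 x \<in> {r_Q q1 q0..1 / (q0 - 1)} \<longleftrightarrow>
          flip q0 q1 x \<in> I_Q q1 q0 \<and> flip q0 q1 x \<notin> {0..<r_Q q1 q0}"
        using f.r_pos by (auto simp: I_Q_def)
      then show "x \<in> flip q0 q1 -` {r_Q q1 q0..1 / (q0 - 1)} \<inter> I_Q q0 q1 \<longleftrightarrow>
          x \<in> I_Q q0 q1 - {l_Q q0 q1<..1 / (q1 - 1)}"
        unfolding core flip_mem_I[OF q] by blast
    qed
    then show "emeasure \<mu> (I_Q q0 q1 - {l_Q q0 q1<..1 / (q1 - 1)}) = 0"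
      using em[of "{r_Q q1 q0..1 / (q0 - 1)}"] f.acim_vanishes_outside[OF ac'] f.r_pos
      by (simp add: acim_sets_iff[OF ac' I] I_Q_def)
  }
qed

end
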